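(* Let $k$ be a field and let $T=\{1,\ldots,d\}$ ($d\ge1$) be equipped with a partial order $\le$. For any $\mathbf Q=(Q_1,\ldots,Q_d)\in\mathbb N^d$ (positive integers, regarded as elements of $k$) there exists $m\in\mathbb N$ such that the $T$-ramified partition algebra $P_n^{(T)}(\mathbf Q)$ is non-semisimple for all $n>m$.
   Context: Write $\underline n=\{1,\ldots,n\}$, and let $\underline n'$, $\underline n''$ be disjoint (primed, doubly primed) copies. $p_n$ is the set of partitions of $\underline n\cup\underline n'$ (identified with equivalence relations). For $a,b\in p_n$ let $b^{+}$ be the partition of $\underline n'\cup\underline n''$ obtained from $b$ by renaming $i\mapsto i'$, $i'\mapsto i''$; let $d_u(ab)$ be the equivalence relation on $\underline n\cup\underline n'\cup\underline n''$ generated by $a$ and $b^{+}$; $c(a,b)$ is the number of parts of $d_u(ab)$ contained in $\underline n'$; $d(ab)\in p_n$ is obtained by restricting $d_u(ab)$ to $\underline n\cup\underline n''$ and renaming $i''\mapsto i'$. $p_n^{(T)}$ is the set of tuples $a=(a_t)_{t\in T}\in\prod_{t\in T}p_n$ such that $t\le t'$ implies that $a_t$ is a refinement of $a_{t'}$ (each part of $a_{t'}$ is a union of parts of $a_t$). For $\mathbf Q\in k^d$, the $T$-ramified partition algebra $P_n^{(T)}(\mathbf Q)$ is the (unital, associative) $k$-algebra with basis $p_n^{(T)}$ and product $ab=\left(\prod_{t\in T}Q_t^{c(a_t,b_t)}\right)(d(a_tb_t))_{t\in T}$. *)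

theory Defs
  imports "HOL-Algebra.Module" "HOL-Algebra.AbelCoset"
begin

section \<open>Semisimple rings\<close>

definition left_ideal :: "'a set \<Rightarrow> ('a, 'm) ring_scheme \<Rightarrow> bool" where
  "left_ideal I R \<longleftrightarrow>
     additive_subgroup I R \<and> (\<forall>a\<in>carrier R. \<forall>x\<in>I. a \<otimes>\<^bsub>R\<^esub> x \<in> I)"

text \<open>Simple as a submodule of the left regular module.\<close>

definition simple_left_ideal :: "'a set \<Rightarrow> ('a, 'm) ring_scheme \<Rightarrow> bool" where
  "simple_left_ideal I R \<longleftrightarrow>
     left_ideal I R \<and> I \<noteq> {\<zero>\<^bsub>R\<^esub>} \<and>
     (\<forall>J. left_ideal J R \<and> J \<subseteq> I \<longrightarrow> J = {\<zero>\<^bsub>R\<^esub>} \<or> J = I)"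

text \<open>
  A unital ring is semisimple if its left regular module is a direct sum of simple submodules;
  such a direct sum has only finitely many summands, since the unit element lies in a finite
  partial sum. For a unital algebra over a field, left ideals are automatically subspaces, so
  this is also semisimplicity as an algebra.
\<close>

definition semisimple_ring :: "('a, 'm) ring_scheme \<Rightarrow> bool" where
  "semisimple_ring R \<longleftrightarrow>
     (\<exists>S. finite S \<and> (\<forall>L\<in>S. simple_left_ideal L R) \<and>
        (\<forall>x\<in>carrier R. \<exists>!f. f \<in> (\<Pi>\<^sub>E L\<in>S. L) \<and> x = (\<Oplus>\<^bsub>R\<^esub>L\<in>S. f L)))"


section \<open>Partitions and their composition\<close>

text \<open>The points \<open>i\<close>, \<open>i'\<close> and \<open>i''\<close>.\<close>

datatype point = Plain nat | Primed nat | DPrimed nat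

definition plain :: "nat \<Rightarrow> point set" where "plain n = Plain ` {1..n}"
definition primed :: "nat \<Rightarrow> point set" where "primed n = Primed ` {1..n}"
definition dprimed :: "nat \<Rightarrow> point set" where "dprimed n = DPrimed ` {1..n}"

text \<open>A partition is represented by its equivalence relation \<open>r\<close>; its parts are the elements
  of the quotient by \<open>r\<close>.\<close>

definition partitions :: "nat \<Rightarrow> point rel set" where
  "partitions n = {r. equiv (plain n \<union> primed n) r}"

text \<open>\<open>refines A r s\<close>: the partition \<open>r\<close> of \<open>A\<close> is a refinement of the partition \<open>s\<close>.\<close>

definition refines :: "'a set \<Rightarrow> 'a rel \<Rightarrow> 'a rel \<Rightarrow> bool" where
  "refines A r s \<longleftrightarrow> (\<forall>B \<in> A // s. \<exists>\<C>. \<C> \<subseteq> A // r \<and> B = \<Union>\<C>)"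

lemma refines_iff_subset:
  assumes r: "equiv A r" and s: "equiv A s"
  shows "refines A r s \<longleftrightarrow> r \<subseteq> s"
proof
  assume ref: "refines A r s"
  show "r \<subseteq> s"
  proof (rule subrelI)
    fix x y assume xy: "(x, y) \<in> r"
    then have x: "x \<in> A" using r by (auto simp: equiv_def)
    then have "s `` {x} \<in> A // s" by (rule quotientI)
    with ref obtain \<C> where C: "\<C> \<subseteq> A // r" "s `` {x} = \<Union>\<C>"
      unfolding refines_def by blast
    have "x \<in> s `` {x}" using s x by (rule equiv_class_self)
    with C obtain C where CC: "C \<in> \<C>" "x \<in> C" by auto
    then have "C \<in> A // r" using C by auto
    then have "y \<in> C" using CC(2) xy r
      by (auto simp: quotient_def equiv_def elim: transE dest: symD)
    then show "(x, y) \<in> s" using C CC by auto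
  qed
next
  assume sub: "r \<subseteq> s"
  show "refines A r s"
    unfolding refines_def
  proof
    fix B assume B: "B \<in> A // s"
    have BA: "B \<subseteq> A" using B s by (auto simp: quotient_def equiv_def)
    have "(\<lambda>x. r `` {x}) ` B \<subseteq> A // r" using BA by (auto intro: quotientI)
    moreover have "B = \<Union> ((\<lambda>x. r `` {x}) ` B)"
    proof
      show "B \<subseteq> \<Union> ((\<lambda>x. r `` {x}) ` B)"
        using equiv_class_self[OF r] BA by fastforce
      show "\<Union> ((\<lambda>x. r `` {x}) ` B) \<subseteq> B"
      proof
        fix y assume "y \<in> \<Union> ((\<lambda>x. r `` {x}) ` B)"
        then obtain x where "x \<in> B" "(x, y) \<in> s" using sub by auto
        then show "y \<in> B" using in_quotient_imp_closed[OF s B] by blast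
      qed
    qed
    ultimately show "\<exists>\<C>. \<C> \<subseteq> A // r \<and> B = \<Union>\<C>" by blast
  qed
qed

text \<open>The renaming \<open>i \<mapsto> i'\<close>, \<open>i' \<mapsto> i''\<close>; the value on doubly primed points is irrelevant.\<close>

fun shift_point :: "point \<Rightarrow> point" where
  "shift_point (Plain i) = Primed i"
| "shift_point (Primed i) = DPrimed i"
| "shift_point (DPrimed i) = DPrimed i"

text \<open>The renaming \<open>i'' \<mapsto> i'\<close>, used only on points that are not singly primed.\<close>

fun drop_point :: "point \<Rightarrow> point" where
  "drop_point (Plain i) = Plain i"
| "drop_point (Primed i) = Primed i"
| "drop_point (DPrimed i) = Primed i"

definition shift :: "point rel \<Rightarrow> point rel" where
  "shift b = map_prod shift_point shift_point ` b"

text \<open>For \<open>a\<close> and \<open>b\<close> in \<open>partitions n\<close> the union of \<open>a\<close> and \<open>shift b\<close> is already symmetric, and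
  reflexive on all three rows, so the equivalence relation it generates is its transitive
  closure.\<close>

definition stack :: "point rel \<Rightarrow> point rel \<Rightarrow> point rel" where
  "stack a b = (a \<union> shift b)\<^sup>+"

lemma equiv_shift:
  assumes "b \<in> partitions n"
  shows "equiv (primed n \<union> dprimed n) (shift b)"
proof -
  let ?V = "plain n \<union> primed n"
  have b: "b \<subseteq> ?V \<times> ?V" "refl_on ?V b" "sym b" "trans b"
    using assms by (auto simp: partitions_def equiv_def)
  have img: "shift_point ` ?V = primed n \<union> dprimed n"
    unfolding plain_def primed_def dprimed_def by (simp add: image_Un image_image)
  have inj: "inj_on shift_point ?V"
    by (auto simp: inj_on_def plain_def primed_def)
  have mem: "(u, v) \<in> shift b \<longleftrightarrow> (\<exists>x y. (x, y) \<in> b \<and> u = shift_point x \<and> v = shift_point y)"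
    for u v by (auto simp: shift_def)
  show ?thesis
  proof (rule equivI)
    show "shift b \<subseteq> (primed n \<union> dprimed n) \<times> (primed n \<union> dprimed n)"
      using b(1) unfolding img[symmetric] by (fastforce simp: mem)
    show "refl_on (primed n \<union> dprimed n) (shift b)"
      unfolding img[symmetric] refl_on_def mem using b(2) by (auto simp: refl_on_def)
    show "sym (shift b)" using b(3) unfolding sym_def mem by blast
    show "trans (shift b)"
    proof (rule transI)
      fix u v w assume "(u, v) \<in> shift b" "(v, w) \<in> shift b"
      then obtain x y y' z where *: "(x, y) \<in> b" "(y', z) \<in> b" "u = shift_point x"
        "v = shift_point y" "v = shift_point y'" "w = shift_point z" unfolding mem by blast
      then have "y = y'" using b(1) inj_onD[OF inj, of y y'] by blast
      with * show "(u, w) \<in> shift b" using b(4) unfolding mem by (blast dest: transD)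
    qed
  qed
qed

lemma equiv_stack:
  assumes "a \<in> partitions n" "b \<in> partitions n"
  shows "equiv (plain n \<union> primed n \<union> dprimed n) (stack a b)"
proof -
  let ?U = "plain n \<union> primed n \<union> dprimed n"
  have a: "a \<subseteq> (plain n \<union> primed n) \<times> (plain n \<union> primed n)"
    "refl_on (plain n \<union> primed n) a" "sym a"
    using assms(1) by (auto simp: partitions_def equiv_def)
  have b: "shift b \<subseteq> (primed n \<union> dprimed n) \<times> (primed n \<union> dprimed n)"
    "refl_on (primed n \<union> dprimed n) (shift b)" "sym (shift b)"
    using equiv_shift[OF assms(2)] by (auto simp: equiv_def)
  have "a \<union> shift b \<subseteq> ?U \<times> ?U" using a(1) b(1) by blast
  then have "stack a b \<subseteq> ?U \<times> ?U" unfolding stack_def by (rule trancl_subset_Sigma)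
  moreover have "refl_on ?U (stack a b)"
    using a(2) b(2) unfolding stack_def refl_on_def by blast
  moreover have "sym (stack a b)"
    unfolding stack_def using a(3) b(3) by (intro sym_trancl sym_Un)
  moreover have "trans (stack a b)" unfolding stack_def by (rule trans_trancl)
  ultimately show ?thesis by (rule equivI)
qed

lemma stack_least:
  assumes "equiv A r" "a \<union> shift b \<subseteq> r"
  shows "stack a b \<subseteq> r"
  using assms trancl_id[of r] trancl_mono_subset[of "a \<union> shift b" r]
  by (auto simp: stack_def equiv_def)

definition closed_parts :: "nat \<Rightarrow> point rel \<Rightarrow> point rel \<Rightarrow> nat" where
  "closed_parts n a b =
     card {B \<in> (plain n \<union> primed n \<union> dprimed n) // stack a b. B \<subseteq> primed n}"

definition compose_partitions :: "nat \<Rightarrow> point rel \<Rightarrow> point rel \<Rightarrow> point rel" where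
  "compose_partitions n a b =
     map_prod drop_point drop_point `
       (stack a b \<inter> (plain n \<union> dprimed n) \<times> (plain n \<union> dprimed n))"


section \<open>The ramified partition algebra\<close>

text \<open>The relation \<open>po\<close> is the partial order on \<open>{1..d}\<close>. Tuples are functions that are
  \<open>undefined\<close> outside \<open>{1..d}\<close>.\<close>

definition ramified_partitions ::
  "nat \<Rightarrow> nat rel \<Rightarrow> nat \<Rightarrow> (nat \<Rightarrow> point rel) set" where
  "ramified_partitions d po n =
     {a \<in> (\<Pi>\<^sub>E t\<in>{1..d}. partitions n).
        \<forall>t\<in>{1..d}. \<forall>t'\<in>{1..d}. (t, t') \<in> po \<longrightarrow> refines (plain n \<union> primed n) (a t) (a t')}"

definition ramified_compose ::
  "nat \<Rightarrow> nat \<Rightarrow> (nat \<Rightarrow> point rel) \<Rightarrow> (nat \<Rightarrow> point rel) \<Rightarrow> (nat \<Rightarrow> point rel)" where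
  "ramified_compose d n a b = (\<lambda>t\<in>{1..d}. compose_partitions n (a t) (b t))"

definition identity_partition :: "nat \<Rightarrow> point rel" where
  "identity_partition n = (\<Union>i\<in>{1..n}. {Plain i, Primed i} \<times> {Plain i, Primed i})"

definition ramified_identity :: "nat \<Rightarrow> nat \<Rightarrow> (nat \<Rightarrow> point rel)" where
  "ramified_identity d n = (\<lambda>t\<in>{1..d}. identity_partition n)"

text \<open>The set of ramified partitions is finite, so the vector space with this basis is the space
  of all coefficient functions vanishing off it. Multiplication is the bilinear extension of
  the product of basis elements.\<close>

definition ramified_partition_algebra ::
  "nat \<Rightarrow> nat rel \<Rightarrow> nat \<Rightarrow> (nat \<Rightarrow> 'k::field) \<Rightarrow> ('k, (nat \<Rightarrow> point rel) \<Rightarrow> 'k) module" where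
  "ramified_partition_algebra d po n Q =
     \<lparr> carrier = {f. \<forall>a. a \<notin> ramified_partitions d po n \<longrightarrow> f a = 0},
       mult = (\<lambda>f g x. \<Sum>a\<in>ramified_partitions d po n. \<Sum>b\<in>ramified_partitions d po n.
         if ramified_compose d n a b = x
         then f a * g b * (\<Prod>t\<in>{1..d}. Q t ^ closed_parts n (a t) (b t)) else 0),
       one = (\<lambda>x. if x = ramified_identity d n then 1 else 0),
       zero = (\<lambda>x. 0),
       add = (\<lambda>f g x. f x + g x),
       smult = (\<lambda>c f x. c * f x) \<rparr>"

end

theory Submission
  imports Defs
begin

text \<open>
  A semisimple ring contains no \<open>x \<noteq> 0\<close> with \<open>x a x = 0\<close> for all \<open>a\<close>. Such an \<open>x\<close> exists here for
  the following reason. Let \<open>m\<close> be minimal in \<open>T\<close>, let \<open>q = Q\<^sub>m < n\<close>, and let \<open>K\<close> be the complete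
  graph on \<open>q + 1\<close> of the \<open>n\<close> points. For \<open>E \<subseteq> K\<close> let \<open>x\<^sub>E\<close> be the tuple whose entry at \<open>m\<close> has
  the connected components of \<open>E\<close> and the whole primed row as parts, all other entries having
  just the two rows as parts; it is ramified because \<open>m\<close> is minimal. Then \<open>x\<^sub>E y x\<^sub>F\<close> is a scalar
  multiple of \<open>x\<^sub>E\<close> for all \<open>y\<close>. The scalar depends on \<open>F\<close> only through a power of \<open>q\<close> counting
  \<open>q\<close>-colourings of the points, weighted independently of \<open>F\<close>, that are constant on the edges
  of \<open>F\<close>. Since \<open>\<Sum>\<^sub>F (-1)\<^bsup>|F|\<^esup> [g constant on F] = \<Prod>\<^bsub>i<j\<^esub> (1 - [g i = g j])\<close> vanishes for every
  \<open>q\<close>-colouring \<open>g\<close> of \<open>q + 1\<close> points, \<open>x = \<Sum>\<^sub>E (-1)\<^bsup>|E|\<^esup> x\<^sub>E\<close> satisfies \<open>x y x = 0\<close>.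

  Counting colourings also represents partitions by matrices, which is how associativity of
  the algebra is obtained.
\<close>

section \<open>Semisimple rings are semiprime\<close>

text \<open>If \<open>x \<otimes> l\<close> were nonzero, the left ideal it generates would be all
  of \<open>L\<close> by simplicity. Writing \<open>l = a \<otimes> (x \<otimes> l)\<close> and
  multiplying by \<open>x\<close> then gives \<open>x \<otimes> l = x \<otimes> a \<otimes> x
  \<otimes> l = \<zero>\<close>.\<close>

lemma (in ring) annihilates_simple_left_ideal:
  assumes L: "simple_left_ideal L R" and x: "x \<in> carrier R" and l: "l \<in> L"
    and nil: "\<And>a. a \<in> carrier R \<Longrightarrow> x \<otimes> a \<otimes> x = \<zero>"
  shows "x \<otimes> l = \<zero>"
proof (rule ccontr)
  assume nz: "x \<otimes> l \<noteq> \<zero>"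
  have LI: "left_ideal L R" using L by (simp add: simple_left_ideal_def)
  then have LR: "L \<subseteq> carrier R"
    by (auto simp: left_ideal_def dest: additive_subgroup.a_subset)
  have lR: "l \<in> carrier R" using l LR by blast
  have xl: "x \<otimes> l \<in> L" using LI l x by (simp add: left_ideal_def)
  define J where "J = (\<lambda>a. a \<otimes> (x \<otimes> l)) ` carrier R"
  have "additive_subgroup J R"
  proof (intro additive_subgroupI add.subgroupI)
    show "J \<subseteq> carrier R" "J \<noteq> {}" using x lR by (auto simp: J_def)
    show "\<ominus> u \<in> J" if "u \<in> J" for u
      using that x lR by (auto simp: J_def l_minus[symmetric])
    show "u \<oplus> v \<in> J" if "u \<in> J" "v \<in> J" for u v
      using that x lR by (auto simp: J_def l_distr[symmetric])
  qed
  moreover have "a \<otimes> u \<in> J" if "a \<in> carrier R" "u \<in> J" for a u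
    using that x lR by (auto simp: J_def m_assoc[symmetric] intro!: image_eqI[OF refl])
  ultimately have "left_ideal J R" by (simp add: left_ideal_def)
  moreover have "J \<subseteq> L" using LI xl by (auto simp: J_def left_ideal_def)
  moreover have "x \<otimes> l \<in> J" using x lR by (auto simp: J_def intro!: image_eqI[of _ _ \<one>])
  ultimately have "J = L" using L nz by (auto simp: simple_left_ideal_def)
  then obtain a where a: "a \<in> carrier R" "l = a \<otimes> (x \<otimes> l)" using l by (auto simp: J_def)
  then have "x \<otimes> l = x \<otimes> a \<otimes> x \<otimes> l" using x lR by (simp add: m_assoc)
  also have "\<dots> = \<zero>" using nil[OF a(1)] lR by simp
  finally show False using nz by simp
qed

text \<open>The unit is a sum of elements of simple left ideals, and \<open>x\<close> annihilates
  each summand.\<close>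

lemma (in ring) semisimple_ring_semiprime:
  assumes ss: "semisimple_ring R" and x: "x \<in> carrier R"
    and nil: "\<And>a. a \<in> carrier R \<Longrightarrow> x \<otimes> a \<otimes> x = \<zero>"
  shows "x = \<zero>"
proof -
  obtain S where S: "finite S" "\<And>L. L \<in> S \<Longrightarrow> simple_left_ideal L R"
    "\<exists>!f. f \<in> (\<Pi>\<^sub>E L\<in>S. L) \<and> \<one> = (\<Oplus>L\<in>S. f L)"
    using ss unfolding semisimple_ring_def by (metis one_closed)
  then obtain f where f: "f \<in> (\<Pi>\<^sub>E L\<in>S. L)" "\<one> = (\<Oplus>L\<in>S. f L)" by blast
  have fL: "f L \<in> L" if "L \<in> S" for L using f that by auto
  have fR: "f \<in> S \<rightarrow> carrier R"
  proof
    fix L assume "L \<in> S"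
    then have "additive_subgroup L R" using S(2)
      by (simp add: simple_left_ideal_def left_ideal_def)
    then have "L \<subseteq> carrier R" by (rule additive_subgroup.a_subset)
    then show "f L \<in> carrier R" using fL \<open>L \<in> S\<close> by blast
  qed
  have "x = x \<otimes> (\<Oplus>L\<in>S. f L)" by (metis f(2) r_one x)
  also have "\<dots> = (\<Oplus>L\<in>S. x \<otimes> f L)" by (rule finsum_rdistr[OF S(1) x fR])
  also have "\<dots> = (\<Oplus>L\<in>S. \<zero>)"
    using annihilates_simple_left_ideal[OF S(2) x fL nil] by (intro finsum_cong') auto
  finally show ?thesis by simp
qed


section \<open>Twisted monoid algebras\<close>

text \<open>A finite monoid twisted by a 2-cocycle \<open>s\<close>: basis elements multiply by
  \<open>comp\<close> up to the scalar \<open>s\<close>, as diagrams do. The equation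
  \<open>cocycle\<close> is what associativity of the bilinear extension needs beyond
  \<open>comp_assoc\<close>.\<close>

locale twisted_monoid =
  fixes P :: "'a set" and comp :: "'a \<Rightarrow> 'a \<Rightarrow> 'a" and e :: 'a
    and s :: "'a \<Rightarrow> 'a \<Rightarrow> 'k::comm_ring_1"
  assumes finite_P: "finite P"
    and comp_closed: "\<lbrakk>a \<in> P; b \<in> P\<rbrakk> \<Longrightarrow> comp a b \<in> P"
    and comp_assoc: "\<lbrakk>a \<in> P; b \<in> P; c \<in> P\<rbrakk> \<Longrightarrow> comp (comp a b) c = comp a (comp b c)"
    and cocycle: "\<lbrakk>a \<in> P; b \<in> P; c \<in> P\<rbrakk> \<Longrightarrow>
      s a b * s (comp a b) c = s b c * s a (comp b c)"
    and e_closed: "e \<in> P"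
    and comp_e: "a \<in> P \<Longrightarrow> comp a e = a" "a \<in> P \<Longrightarrow> comp e a = a"
    and s_e: "a \<in> P \<Longrightarrow> s a e = 1" "a \<in> P \<Longrightarrow> s e a = 1"
begin

definition product :: "('a \<Rightarrow> 'k) \<Rightarrow> ('a \<Rightarrow> 'k) \<Rightarrow> 'a \<Rightarrow> 'k" where
  "product f g x = (\<Sum>a\<in>P. \<Sum>b\<in>P. if comp a b = x then f a * g b * s a b else 0)"

text \<open>Each pair \<open>(a, b)\<close> contributes to the single coefficient at
  \<open>comp a b\<close>, so pairing \<open>product f g\<close> with a weight \<open>w\<close>
  evaluates \<open>w\<close> there. This unfolds both nested products in the associativity
  proof.\<close>

lemma sum_product_mult:
  "(\<Sum>y\<in>P. product f g y * w y) = (\<Sum>a\<in>P. \<Sum>b\<in>P. f a * g b * s a b * w (comp a b))"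
proof -
  have "(\<Sum>y\<in>P. product f g y * w y) =
      (\<Sum>y\<in>P. \<Sum>a\<in>P. \<Sum>b\<in>P. if y = comp a b then f a * g b * s a b * w y else 0)"
    unfolding product_def sum_distrib_right by (intro sum.cong) auto
  also have "\<dots> =
      (\<Sum>a\<in>P. \<Sum>b\<in>P. \<Sum>y\<in>P. if y = comp a b then f a * g b * s a b * w y else 0)"
    by (rule trans[OF sum.swap], rule sum.cong[OF refl], rule sum.swap)
  also have "\<dots> = (\<Sum>a\<in>P. \<Sum>b\<in>P. f a * g b * s a b * w (comp a b))"
    by (intro sum.cong refl) (simp add: finite_P comp_closed)
  finally show ?thesis .
qed

lemma product_product_left:
  "product (product f g) h x = (\<Sum>a\<in>P. \<Sum>b\<in>P. f a * g b * s a b *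
     (\<Sum>c\<in>P. if comp (comp a b) c = x then h c * s (comp a b) c else 0))"
  by (subst sum_product_mult[symmetric], subst product_def)
    (auto simp: sum_distrib_left mult_ac intro!: sum.cong)

lemma product_assoc: "product (product f g) h = product f (product g h)"
proof
  fix x
  have "product f (product g h) x = (\<Sum>a\<in>P. \<Sum>b\<in>P. product g h b *
      (if comp a b = x then f a * s a b else 0))"
    unfolding product_def[of f] by (intro sum.cong) (auto simp: mult_ac)
  also have "\<dots> = (\<Sum>a\<in>P. \<Sum>b\<in>P. \<Sum>c\<in>P. g b * h c * s b c *
      (if comp a (comp b c) = x then f a * s a (comp b c) else 0))"
    by (simp only: sum_product_mult)
  also have "\<dots> = (\<Sum>a\<in>P. \<Sum>b\<in>P. \<Sum>c\<in>P. f a * g b * s a b *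
      (if comp (comp a b) c = x then h c * s (comp a b) c else 0))"
  proof (intro sum.cong refl)
    fix a b c assume abc: "a \<in> P" "b \<in> P" "c \<in> P"
    have "g b * h c * s b c * (f a * s a (comp b c)) = f a * g b * h c * (s b c * s a (comp b c))"
      by (simp add: mult_ac)
    also have "\<dots> = f a * g b * s a b * (h c * s (comp a b) c)"
      by (simp add: cocycle[OF abc, symmetric] mult_ac)
    finally show "g b * h c * s b c * (if comp a (comp b c) = x then f a * s a (comp b c) else 0)
      = f a * g b * s a b * (if comp (comp a b) c = x then h c * s (comp a b) c else 0)"
      using comp_assoc[OF abc] by simp
  qed
  finally show "product (product f g) h x = product f (product g h) x"
    by (simp add: product_product_left sum_distrib_left)
qed

text \<open>\<open>product\<close> always vanishes off \<open>P\<close>, so the unit law can hold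
  only for functions supported there.\<close>

lemma product_one_left:
  assumes "\<forall>a. a \<notin> P \<longrightarrow> f a = 0"
  shows "product (\<lambda>x. if x = e then 1 else 0) f = f"
proof
  fix x
  have "product (\<lambda>x. if x = e then 1 else 0) f x =
      (\<Sum>a\<in>P. if a = e then (\<Sum>b\<in>P. if comp a b = x then f b * s a b else 0) else 0)"
    unfolding product_def by (intro sum.cong) (auto intro!: sum.neutral cong: if_cong)
  also have "\<dots> = (\<Sum>b\<in>P. if b = x then f b else 0)"
    by (simp add: finite_P e_closed comp_e s_e cong: sum.cong if_cong)
  finally show "product (\<lambda>x. if x = e then 1 else 0) f x = f x"
    using assms by (simp add: finite_P)
qed

lemma product_one_right:
  assumes "\<forall>a. a \<notin> P \<longrightarrow> f a = 0"
  shows "product f (\<lambda>x. if x = e then 1 else 0) = f"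
proof
  fix x
  have "product f (\<lambda>x. if x = e then 1 else 0) x =
      (\<Sum>a\<in>P. \<Sum>b\<in>P. if b = e then (if comp a b = x then f a * s a b else 0) else 0)"
    unfolding product_def by (intro sum.cong) auto
  also have "\<dots> = (\<Sum>a\<in>P. if a = x then f a else 0)"
    by (simp add: finite_P e_closed comp_e s_e cong: sum.cong if_cong)
  finally show "product f (\<lambda>x. if x = e then 1 else 0) x = f x"
    using assms by (simp add: finite_P)
qed

lemma product_outside:
  assumes "x \<notin> P"
  shows "product f g x = 0"
  unfolding product_def using assms comp_closed by (auto intro!: sum.neutral)

lemma product_add_left: "product (\<lambda>x. f x + g x) h = (\<lambda>x. product f h x + product g h x)"
  unfolding product_def sum.distrib[symmetric] by (intro ext sum.cong) (auto simp: algebra_simps)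

lemma product_add_right: "product h (\<lambda>x. f x + g x) = (\<lambda>x. product h f x + product h g x)"
  unfolding product_def sum.distrib[symmetric] by (intro ext sum.cong) (auto simp: algebra_simps)

text \<open>An arbitrary record \<open>R\<close> is allowed, so that the result applies to a module
  record with its additional \<open>smult\<close> field.\<close>

lemma ring_twisted_algebra:
  fixes R :: "('a \<Rightarrow> 'k, 'm) ring_scheme"
  assumes R: "carrier R = {f. \<forall>a. a \<notin> P \<longrightarrow> f a = 0}"
    "mult R = product" "one R = (\<lambda>x. if x = e then 1 else 0)"
    "zero R = (\<lambda>x. 0)" "add R = (\<lambda>f g x. f x + g x)"
  shows "ring R"
proof (rule ringI)
  show "abelian_group R"
  proof (rule abelian_groupI)
    show "\<exists>y\<in>carrier R. y \<oplus>\<^bsub>R\<^esub> f = \<zero>\<^bsub>R\<^esub>" if "f \<in> carrier R" for f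
      using that by (intro bexI[of _ "\<lambda>x. - f x"]) (auto simp: R)
  qed (auto simp: R algebra_simps)
  show "monoid R"
    by (rule monoidI) (use e_closed in \<open>auto simp: R product_outside product_assoc
      product_one_left product_one_right\<close>)
qed (auto simp: R product_add_left product_add_right)

end


section \<open>Colourings\<close>

text \<open>A partition \<open>a\<close> acts on the \<open>n\<close>-th tensor power of a \<open>q\<close>-dimensional space by the matrix
  with rows and columns indexed by colourings of \<open>{1..n}\<close>, whose entry at \<open>(f, g)\<close> is 1 if
  \<open>compatible a f g\<close> and 0 otherwise.\<close>

definition colourings :: "nat \<Rightarrow> nat \<Rightarrow> (nat \<Rightarrow> nat) set" where
  "colourings q n = ({1..n} \<rightarrow>\<^sub>E {..<q})"

fun colour :: "(nat \<Rightarrow> nat) \<Rightarrow> (nat \<Rightarrow> nat) \<Rightarrow> (nat \<Rightarrow> nat) \<Rightarrow> point \<Rightarrow> nat" where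
  "colour f g h (Plain i) = f i"
| "colour f g h (Primed i) = g i"
| "colour f g h (DPrimed i) = h i"

text \<open>The third row of \<open>colour\<close> is a placeholder here: relations in
  \<open>partitions n\<close> contain no doubly primed points.\<close>

definition compatible :: "point rel \<Rightarrow> (nat \<Rightarrow> nat) \<Rightarrow> (nat \<Rightarrow> nat) \<Rightarrow> bool" where
  "compatible a f g \<longleftrightarrow> (\<forall>(x, y)\<in>a. colour f g g x = colour f g g y)"

lemma finite_colourings [simp]: "finite (colourings q n)"
  by (simp add: colourings_def finite_PiE)

lemma const_in_colourings: "q > 0 \<Longrightarrow> restrict (\<lambda>_. 0) {1..n} \<in> colourings q n"
  by (auto simp: colourings_def)

lemma compatible_const:
  assumes "a \<in> partitions n"
  shows "compatible a (restrict (\<lambda>_. k) {1..n}) (restrict (\<lambda>_. k) {1..n})"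
proof -
  have "a \<subseteq> (plain n \<union> primed n) \<times> (plain n \<union> primed n)"
    using assms by (simp add: partitions_def equiv_def)
  moreover have "colour (restrict (\<lambda>_. k) {1..n}) (restrict (\<lambda>_. k) {1..n})
      (restrict (\<lambda>_. k) {1..n}) x = k" if "x \<in> plain n \<union> primed n" for x
    using that by (auto simp: plain_def primed_def)
  ultimately show ?thesis by (fastforce simp: compatible_def)
qed

text \<open>Having equal colours is an equivalence relation, so a colouring of all three rows
  respects \<open>stack a b\<close> as soon as it respects the generators \<open>a\<close> and
  \<open>shift b\<close>.\<close>

lemma compatible_stack:
  assumes a: "a \<in> partitions n"
    and b: "b \<in> partitions n"
  shows "compatible a f g \<and> compatible b g h \<longleftrightarrow>
    (\<forall>(x, y)\<in>stack a b. colour f g h x = colour f g h y)" (is "?l \<longleftrightarrow> ?r")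
proof -
  have sub: "a \<subseteq> (plain n \<union> primed n) \<times> (plain n \<union> primed n)"
    "b \<subseteq> (plain n \<union> primed n) \<times> (plain n \<union> primed n)"
    using a b by (simp_all add: partitions_def equiv_def)
  have 1: "colour f g g x = colour f g h x" "colour g h h x = colour f g h (shift_point x)"
    if "x \<in> plain n \<union> primed n" for x
    using that by (auto simp: plain_def primed_def)
  have "compatible a f g \<longleftrightarrow> (\<forall>(x, y)\<in>a. colour f g h x = colour f g h y)"
    unfolding compatible_def using sub(1) 1(1) by (intro ball_cong refl) auto
  moreover have "compatible b g h \<longleftrightarrow> (\<forall>(x, y)\<in>shift b. colour f g h x = colour f g h y)"
  proof -
    have "compatible b g h \<longleftrightarrow>
      (\<forall>(x, y)\<in>b. colour f g h (shift_point x) = colour f g h (shift_point y))"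
      unfolding compatible_def using sub(2) 1(2) by (intro ball_cong refl) auto
    then show ?thesis by (auto simp: shift_def split_beta)
  qed
  ultimately have "?l \<longleftrightarrow> (\<forall>(x, y)\<in>a \<union> shift b. colour f g h x = colour f g h y)" by blast
  also have "\<dots> \<longleftrightarrow> ?r"
  proof
    assume *: "\<forall>(x, y)\<in>a \<union> shift b. colour f g h x = colour f g h y"
    have "colour f g h x = colour f g h y" if "(x, y) \<in> (a \<union> shift b)\<^sup>+" for x y
      using that by (induction rule: trancl_induct) (use * in auto)
    then show ?r by (auto simp: stack_def)
  qed (auto simp: stack_def)
  finally show ?thesis .
qed

text \<open>Only the outer rows occur on the right, so the middle colouring \<open>g\<close> there
  is arbitrary.\<close>

lemma compatible_compose:
  "compatible (compose_partitions n a b) f h \<longleftrightarrow>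
    (\<forall>(x, y)\<in>stack a b \<inter> (plain n \<union> dprimed n) \<times> (plain n \<union> dprimed n).
      colour f g h x = colour f g h y)"
proof -
  have 1: "colour f h h (drop_point x) = colour f g h x" if "x \<in> plain n \<union> dprimed n" for x
    using that by (auto simp: plain_def dprimed_def)
  have "compatible (compose_partitions n a b) f h \<longleftrightarrow>
    (\<forall>(x, y)\<in>stack a b \<inter> (plain n \<union> dprimed n) \<times> (plain n \<union> dprimed n).
      colour f h h (drop_point x) = colour f h h (drop_point y))"
    by (auto simp: compatible_def compose_partitions_def split_beta)
  also have "\<dots> \<longleftrightarrow> (\<forall>(x, y)\<in>stack a b \<inter> (plain n \<union> dprimed n) \<times> (plain n \<union> dprimed n).
      colour f g h x = colour f g h y)"
    using 1 by (intro ball_cong refl) auto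
  finally show ?thesis .
qed

text \<open>A colouring of the middle row is free on the parts inside that row and
  forced everywhere else.\<close>

lemma card_compatible:
  assumes a: "a \<in> partitions n" and b: "b \<in> partitions n"
    and f: "f \<in> colourings q n" and h: "h \<in> colourings q n"
  shows "card {g \<in> colourings q n. compatible a f g \<and> compatible b g h} =
    (if compatible (compose_partitions n a b) f h then q ^ closed_parts n a b else 0)"
proof (cases "compatible (compose_partitions n a b) f h")
  case False
  then have "{g \<in> colourings q n. compatible a f g \<and> compatible b g h} = {}"
    using compatible_compose[of n a b f h] compatible_stack[OF a b] by fastforce
  then show ?thesis using False by simp
next
  case True
  define U where "U = plain n \<union> primed n \<union> dprimed n"
  define W where "W = plain n \<union> dprimed n"
  define S where "S = stack a b"
  define free where "free = {B \<in> U // S. B \<subseteq> primed n}"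
  \<comment> \<open>\<open>rep x\<close> is a point of the outer rows in the part of
    \<open>x\<close>; it exists exactly when that part is not inside the middle row.\<close>
  define rep where "rep x = (SOME w. w \<in> S `` {x} \<inter> W)" for x
  \<comment> \<open>A choice \<open>G\<close> of colours for the free parts determines all colours:
    a part meeting the outer rows inherits its colour from there. The middle argument of
    \<open>colour f f h\<close> is a placeholder.\<close>
  define val where "val G x = (if S `` {x} \<subseteq> primed n then G (S `` {x}) else colour f f h (rep x))"
    for G :: "point set \<Rightarrow> nat" and x
  define \<Phi> where "\<Phi> G = (\<lambda>i\<in>{1..n}. val G (Primed i))" for G
  have S: "equiv U S" unfolding U_def S_def using equiv_stack[OF a b] .
  have SU: "S `` {x} \<subseteq> U" for x using S by (auto simp: equiv_def)
  have disj: "W \<inter> primed n = {}" by (auto simp: W_def plain_def primed_def dprimed_def)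
  have UW: "U = W \<union> primed n" by (auto simp: U_def W_def)
  have rep: "(x, rep x) \<in> S" "rep x \<in> W" if "\<not> S `` {x} \<subseteq> primed n" for x
  proof -
    have "\<exists>w. w \<in> S `` {x} \<inter> W" using that SU[of x] UW by blast
    then have "rep x \<in> S `` {x} \<inter> W" unfolding rep_def by (rule someI_ex)
    then show "(x, rep x) \<in> S" "rep x \<in> W" by auto
  qed
  have colW: "colour f g h x = colour f f h x" if "x \<in> W" for x g
    using that by (auto simp: W_def plain_def dprimed_def)
  have colWq: "colour f f h x < q" if "x \<in> W" for x
    using that f h by (auto simp: W_def plain_def dprimed_def colourings_def PiE_iff)
  \<comment> \<open>Compatibility of the composite makes the forced colours independent of the
    chosen outer point.\<close>
  have const: "colour f f h x = colour f f h y" if "(x, y) \<in> S" "x \<in> W" "y \<in> W" for x y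
    using True that unfolding compatible_compose[of n a b f h f] by (auto simp: S_def W_def)
  have finU: "finite U" by (simp add: U_def plain_def primed_def dprimed_def)
  then have finfree: "finite free" unfolding free_def
    using finite_quotient[OF finU] S by (auto simp: equiv_def)
  have colval: "colour f (\<Phi> G) h x = val G x" if "x \<in> U" for x G
  proof (cases "x \<in> W")
    case True
    then have "x \<in> S `` {x}" using S \<open>x \<in> U\<close> by (rule_tac equiv_class_self)
    then have 1: "\<not> S `` {x} \<subseteq> primed n" using True disj by blast
    then show ?thesis using const[OF rep(1)[OF 1] True rep(2)[OF 1]] colW[OF True]
      by (simp add: val_def)
  next
    case False
    then show ?thesis using that UW by (auto simp: primed_def \<Phi>_def)
  qed
  have "bij_betw \<Phi> (free \<rightarrow>\<^sub>E {..<q})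
    {g \<in> colourings q n. \<forall>(x, y)\<in>S. colour f g h x = colour f g h y}"
    unfolding bij_betw_def
  proof
    show "inj_on \<Phi> (free \<rightarrow>\<^sub>E {..<q})"
    proof (rule inj_onI)
      fix G1 G2 assume G: "G1 \<in> free \<rightarrow>\<^sub>E {..<q}" "G2 \<in> free \<rightarrow>\<^sub>E {..<q}" "\<Phi> G1 = \<Phi> G2"
      show "G1 = G2"
      proof (rule PiE_ext[OF G(1,2)])
        fix B assume B: "B \<in> free"
        then obtain x where x: "x \<in> U" "B = S `` {x}" by (auto simp: free_def elim: quotientE)
        have "val G1 x = val G2 x" using colval[OF x(1)] G(3) by metis
        then show "G1 B = G2 B" using B x(2) by (simp add: val_def free_def)
      qed
    qed
    show "\<Phi> ` (free \<rightarrow>\<^sub>E {..<q}) =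
      {g \<in> colourings q n. \<forall>(x, y)\<in>S. colour f g h x = colour f g h y}"
    proof (intro equalityI subsetI)
      fix g assume "g \<in> \<Phi> ` (free \<rightarrow>\<^sub>E {..<q})"
      then obtain G where G: "G \<in> free \<rightarrow>\<^sub>E {..<q}" "g = \<Phi> G" by blast
      have "val G (Primed i) < q" if "i \<in> {1..n}" for i
      proof (cases "S `` {Primed i} \<subseteq> primed n")
        case True
        then have "S `` {Primed i} \<in> free" using that
          by (auto simp: free_def U_def primed_def intro!: quotientI)
        then show ?thesis using G(1) True by (auto simp: val_def)
      next
        case False
        then show ?thesis using colWq[OF rep(2)[OF False]] by (simp add: val_def)
      qed
      then have "g \<in> colourings q n" by (auto simp: G(2) \<Phi>_def colourings_def)
      moreover have "colour f g h x = colour f g h y" if xy: "(x, y) \<in> S" for x y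
      proof -
        have "x \<in> U" "y \<in> U" using xy S by (auto simp: equiv_def)
        moreover have "S `` {x} = S `` {y}" using equiv_class_eq[OF S xy] .
        ultimately show ?thesis by (simp add: G(2) colval val_def rep_def)
      qed
      ultimately show "g \<in> {g \<in> colourings q n. \<forall>(x, y)\<in>S. colour f g h x = colour f g h y}"
        by auto
    next
      fix g assume "g \<in> {g \<in> colourings q n. \<forall>(x, y)\<in>S. colour f g h x = colour f g h y}"
      then have g: "g \<in> colourings q n" and gc: "\<And>x y. (x, y) \<in> S \<Longrightarrow> colour f g h x = colour f g h y"
        by auto
      define G where "G = (\<lambda>B\<in>free. colour f g h (SOME x. x \<in> B))"
      have some: "(SOME x. x \<in> B) \<in> B" if "B \<in> free" for B
        using that in_quotient_imp_non_empty[OF S] by (auto simp: free_def some_in_eq)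
      have "colour f g h (SOME x. x \<in> B) < q" if "B \<in> free" for B
      proof -
        have "(SOME x. x \<in> B) \<in> primed n" using some[OF that] that by (auto simp: free_def)
        then show ?thesis using g by (auto simp: primed_def colourings_def)
      qed
      then have "G \<in> free \<rightarrow>\<^sub>E {..<q}" by (auto simp: G_def)
      moreover have "val G (Primed i) = g i" if i: "i \<in> {1..n}" for i
      proof (cases "S `` {Primed i} \<subseteq> primed n")
        case True
        then have B: "S `` {Primed i} \<in> free" using i
          by (auto simp: free_def U_def primed_def intro!: quotientI)
        have "(Primed i, SOME x. x \<in> S `` {Primed i}) \<in> S" using some[OF B] by blast
        from gc[OF this] show ?thesis using B True by (simp add: val_def G_def)
      next
        case False
        then show ?thesis
          using gc[OF rep(1)[OF False]] colW[OF rep(2)[OF False], of g] by (simp add: val_def)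
      qed
      then have "\<Phi> G = g" using g
        by (intro ext) (auto simp: \<Phi>_def colourings_def restrict_def PiE_def extensional_def)
      ultimately show "g \<in> \<Phi> ` (free \<rightarrow>\<^sub>E {..<q})" by blast
    qed
  qed
  then have "card {g \<in> colourings q n. \<forall>(x, y)\<in>S. colour f g h x = colour f g h y} = q ^ card free"
    using finfree by (simp add: bij_betw_same_card[symmetric] card_funcsetE)
  then show ?thesis using True
    by (simp add: compatible_stack[OF a b] S_def free_def U_def closed_parts_def)
qed

text \<open>For \<open>q > 0\<close> the count in \<open>card_compatible\<close> is nonzero exactly
  when the composite is compatible. Forgetting the scalar, composition becomes multiplication of
  Boolean matrices.\<close>

corollary compatible_compose_iff:
  assumes "a \<in> partitions n" "b \<in> partitions n" "f \<in> colourings q n" "h \<in> colourings q n"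
    and "q > 0"
  shows "compatible (compose_partitions n a b) f h \<longleftrightarrow>
    (\<exists>g\<in>colourings q n. compatible a f g \<and> compatible b g h)"
proof -
  have "card {g \<in> colourings q n. compatible a f g \<and> compatible b g h} \<noteq> 0 \<longleftrightarrow>
      (\<exists>g\<in>colourings q n. compatible a f g \<and> compatible b g h)"
    by auto
  moreover have "card {g \<in> colourings q n. compatible a f g \<and> compatible b g h} \<noteq> 0 \<longleftrightarrow>
      compatible (compose_partitions n a b) f h"
    unfolding card_compatible[OF assms(1-4)] using assms(5) by simp
  ultimately show ?thesis by (rule trans[OF sym, rotated])
qed

text \<open>Constant colourings of the outer rows are compatible with every partition, so the count
  at such a pair is a pure power of \<open>q\<close>.\<close>

lemma card_compatible_const:
  assumes "a \<in> partitions n" "b \<in> partitions n" and "q > 0"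
  defines "z \<equiv> restrict (\<lambda>_. 0) {1..n}"
  assumes "compose_partitions n a b \<in> partitions n"
  shows "card {g \<in> colourings q n. compatible a z g \<and> compatible b g z} = q ^ closed_parts n a b"
  unfolding z_def using card_compatible[OF assms(1,2), of "restrict (\<lambda>_. 0) {1..n}" q]
    const_in_colourings[OF assms(3)] compatible_const[OF assms(5)] by simp

text \<open>Two colours suffice to recover a partition, since they separate any part from its
  complement.\<close>

lemma partition_eqI:
  assumes a: "a \<in> partitions n" and b: "b \<in> partitions n"
    and eq: "\<And>f g. \<lbrakk>f \<in> colourings 2 n; g \<in> colourings 2 n\<rbrakk> \<Longrightarrow>
      compatible a f g \<longleftrightarrow> compatible b f g"
  shows "a = b"
proof -
  have sub: "r \<subseteq> r'" if r: "r \<in> partitions n" and r': "r' \<in> partitions n"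
    and imp: "\<And>f g. \<lbrakk>f \<in> colourings 2 n; g \<in> colourings 2 n\<rbrakk> \<Longrightarrow>
      compatible r' f g \<Longrightarrow> compatible r f g" for r r'
  proof (rule subrelI)
    fix x y assume xy: "(x, y) \<in> r"
    \<comment> \<open>Together \<open>f\<close> and \<open>g\<close> form the indicator function of
      the part of \<open>x\<close> in \<open>r'\<close>. It respects \<open>r'\<close>, hence
      \<open>r\<close>, so it takes the value 1 at \<open>y\<close> too.\<close>
    define f where "f = (\<lambda>i\<in>{1..n}. of_bool ((x, Plain i) \<in> r') :: nat)"
    define g where "g = (\<lambda>i\<in>{1..n}. of_bool ((x, Primed i) \<in> r') :: nat)"
    have fg: "f \<in> colourings 2 n" "g \<in> colourings 2 n" by (auto simp: f_def g_def colourings_def)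
    have eqs: "equiv (plain n \<union> primed n) r" "equiv (plain n \<union> primed n) r'"
      using r r' by (auto simp: partitions_def)
    have col: "colour f g g z = of_bool ((x, z) \<in> r')" if "z \<in> plain n \<union> primed n" for z
      using that by (auto simp: f_def g_def plain_def primed_def)
    have "compatible r' f g"
      unfolding compatible_def
    proof clarify
      fix u v assume uv: "(u, v) \<in> r'"
      then have "u \<in> plain n \<union> primed n" "v \<in> plain n \<union> primed n"
        using eqs(2) by (auto simp: equiv_def)
      moreover have "(x, u) \<in> r' \<longleftrightarrow> (x, v) \<in> r'"
        using uv eqs(2) by (meson equivE symD transD)
      ultimately show "colour f g g u = colour f g g v" by (simp add: col)
    qed
    then have "compatible r f g" using imp[OF fg] by simp
    then have "colour f g g x = colour f g g y" using xy by (auto simp: compatible_def)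
    moreover have "x \<in> plain n \<union> primed n" "y \<in> plain n \<union> primed n"
      using xy eqs(1) by (auto simp: equiv_def)
    moreover from this have "(x, x) \<in> r'" using eqs(2) by (auto simp: equiv_def refl_on_def)
    ultimately show "(x, y) \<in> r'" by (cases "(x, y) \<in> r'") (simp_all add: col)
  qed
  show ?thesis using sub[OF a b] sub[OF b a] eq by blast
qed


section \<open>The monoid of partitions\<close>

lemma compose_in_partitions:
  assumes "a \<in> partitions n" "b \<in> partitions n"
  shows "compose_partitions n a b \<in> partitions n"
proof -
  let ?W = "plain n \<union> dprimed n"
  let ?S = "stack a b \<inter> ?W \<times> ?W"
  have S: "stack a b \<subseteq> (plain n \<union> primed n \<union> dprimed n) \<times> (plain n \<union> primed n \<union> dprimed n)"
    "refl_on (plain n \<union> primed n \<union> dprimed n) (stack a b)" "sym (stack a b)" "trans (stack a b)"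
    using equiv_stack[OF assms] by (auto simp: equiv_def)
  have img: "drop_point ` ?W = plain n \<union> primed n"
    unfolding plain_def primed_def dprimed_def by (simp add: image_Un image_image)
  have inj: "x = y" if "x \<in> ?W" "y \<in> ?W" "drop_point x = drop_point y" for x y
    using that by (auto simp: plain_def dprimed_def)
  have mem: "(u, v) \<in> compose_partitions n a b \<longleftrightarrow>
      (\<exists>x y. (x, y) \<in> ?S \<and> u = drop_point x \<and> v = drop_point y)" for u v
    by (auto simp: compose_partitions_def)
  have "equiv (plain n \<union> primed n) (compose_partitions n a b)"
  proof (rule equivI)
    show "compose_partitions n a b \<subseteq> (plain n \<union> primed n) \<times> (plain n \<union> primed n)"
      unfolding img[symmetric] by (fastforce simp: mem)
    show "refl_on (plain n \<union> primed n) (compose_partitions n a b)"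
      unfolding img[symmetric] refl_on_def mem using S(2) by (auto simp: refl_on_def)
    show "sym (compose_partitions n a b)" using S(3) unfolding sym_def mem by blast
    show "trans (compose_partitions n a b)"
    proof (rule transI)
      fix u v w assume "(u, v) \<in> compose_partitions n a b" "(v, w) \<in> compose_partitions n a b"
      then obtain x y y' z where *: "(x, y) \<in> ?S" "(y', z) \<in> ?S" "u = drop_point x"
        "v = drop_point y" "v = drop_point y'" "w = drop_point z" unfolding mem by blast
      then have "y = y'" using inj[of y y'] by blast
      with * have "(x, z) \<in> ?S" using S(4) by (blast dest: transD)
      with * show "(u, w) \<in> compose_partitions n a b" unfolding mem by blast
    qed
  qed
  then show ?thesis by (simp add: partitions_def)
qed

text \<open>Both sides become the existence of two intermediate colourings, as in associativity of
  Boolean matrix multiplication.\<close>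

lemma compose_assoc:
  assumes a: "a \<in> partitions n" and b: "b \<in> partitions n" and c: "c \<in> partitions n"
  shows "compose_partitions n (compose_partitions n a b) c =
    compose_partitions n a (compose_partitions n b c)"
proof (rule partition_eqI[of _ n])
  fix f g assume "f \<in> colourings 2 n" "g \<in> colourings 2 n"
  then show "compatible (compose_partitions n (compose_partitions n a b) c) f g \<longleftrightarrow>
      compatible (compose_partitions n a (compose_partitions n b c)) f g"
    by (simp add: compatible_compose_iff[where q = 2] compose_in_partitions a b c) blast
qed (simp_all add: compose_in_partitions a b c)

text \<open>Both sums are the exponent of 2 in one count: the pairs of intermediate two-colourings
  of the three stacked partitions with constant outer rows. The two orders of summation give the two
  sides.\<close>

lemma closed_parts_cocycle:
  assumes a: "a \<in> partitions n" and b: "b \<in> partitions n" and c: "c \<in> partitions n"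
  shows "closed_parts n a b + closed_parts n (compose_partitions n a b) c =
    closed_parts n b c + closed_parts n a (compose_partitions n b c)"
proof -
  let ?C = "colourings 2 n"
  define z :: "nat \<Rightarrow> nat" where "z = restrict (\<lambda>_. 0) {1..n}"
  have z: "z \<in> ?C" using const_in_colourings[of 2 n] by (simp add: z_def)
  have zz: "compatible r z z" if "r \<in> partitions n" for r
    using compatible_const[OF that] by (simp add: z_def)
  have card: "card {g \<in> ?C. R g} = (\<Sum>g\<in>?C. of_bool (R g))" for R
    by (simp add: sum_of_bool_eq Int_def)
  have "(\<Sum>g\<in>?C. \<Sum>g'\<in>?C. of_bool (compatible a z g' \<and> compatible b g' g \<and> compatible c g z)) =
      (\<Sum>g\<in>?C. of_bool (compatible c g z) *
        card {g' \<in> ?C. compatible a z g' \<and> compatible b g' g})"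
    unfolding card sum_distrib_left by (intro sum.cong refl) auto
  also have "\<dots> = (\<Sum>g\<in>?C. of_bool (compatible c g z) *
      (if compatible (compose_partitions n a b) z g then 2 ^ closed_parts n a b else 0))"
    by (intro sum.cong refl) (simp only: card_compatible[OF a b z])
  also have "\<dots> = 2 ^ closed_parts n a b *
      card {g \<in> ?C. compatible (compose_partitions n a b) z g \<and> compatible c g z}"
    unfolding card sum_distrib_left by (intro sum.cong refl) auto
  also have "\<dots> = 2 ^ (closed_parts n a b + closed_parts n (compose_partitions n a b) c)"
    using a b c by (simp add: card_compatible z zz compose_in_partitions power_add)
  finally have 1: "(\<Sum>g\<in>?C. \<Sum>g'\<in>?C.
      of_bool (compatible a z g' \<and> compatible b g' g \<and> compatible c g z)) =
      (2::nat) ^ (closed_parts n a b + closed_parts n (compose_partitions n a b) c)" .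
  have "(\<Sum>g'\<in>?C. \<Sum>g\<in>?C. of_bool (compatible a z g' \<and> compatible b g' g \<and> compatible c g z)) =
      (\<Sum>g'\<in>?C. of_bool (compatible a z g') *
        card {g \<in> ?C. compatible b g' g \<and> compatible c g z})"
    unfolding card sum_distrib_left by (intro sum.cong refl) auto
  also have "\<dots> = (\<Sum>g\<in>?C. of_bool (compatible a z g) *
      (if compatible (compose_partitions n b c) g z then 2 ^ closed_parts n b c else 0))"
    by (intro sum.cong refl) (simp only: card_compatible[OF b c _ z])
  also have "\<dots> = 2 ^ closed_parts n b c *
      card {g \<in> ?C. compatible a z g \<and> compatible (compose_partitions n b c) g z}"
    unfolding card sum_distrib_left by (intro sum.cong refl) auto
  also have "\<dots> = 2 ^ (closed_parts n b c + closed_parts n a (compose_partitions n b c))"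
    using a b c by (simp add: card_compatible z zz compose_in_partitions power_add)
  finally have "(2::nat) ^ (closed_parts n a b + closed_parts n (compose_partitions n a b) c) =
      2 ^ (closed_parts n b c + closed_parts n a (compose_partitions n b c))"
    using 1 by (subst (asm) (2) sum.swap) simp
  then show ?thesis by simp
qed

lemma identity_in_partitions: "identity_partition n \<in> partitions n"
proof -
  have mem: "(x, y) \<in> identity_partition n \<longleftrightarrow>
      (\<exists>i\<in>{1..n}. (x = Plain i \<or> x = Primed i) \<and> (y = Plain i \<or> y = Primed i))" for x y
    by (auto simp: identity_partition_def)
  have "equiv (plain n \<union> primed n) (identity_partition n)"
  proof (rule equivI)
    show "identity_partition n \<subseteq> (plain n \<union> primed n) \<times> (plain n \<union> primed n)"
      by (auto simp: mem plain_def primed_def)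
    show "refl_on (plain n \<union> primed n) (identity_partition n)"
      by (auto simp: refl_on_def mem plain_def primed_def)
    show "sym (identity_partition n)" unfolding sym_def mem by blast
    show "trans (identity_partition n)" unfolding trans_def mem by auto
  qed
  then show ?thesis by (simp add: partitions_def)
qed

lemma compatible_identity:
  assumes "f \<in> colourings q n" "g \<in> colourings q n"
  shows "compatible (identity_partition n) f g \<longleftrightarrow> f = g"
proof -
  have "compatible (identity_partition n) f g \<longleftrightarrow> (\<forall>i\<in>{1..n}. f i = g i)"
    by (auto simp: compatible_def identity_partition_def)
  also have "\<dots> \<longleftrightarrow> f = g" using assms PiE_ext unfolding colourings_def by blast
  finally show ?thesis .
qed

lemma compose_identity:
  assumes a: "a \<in> partitions n"
  shows "compose_partitions n a (identity_partition n) = a"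
    and "compose_partitions n (identity_partition n) a = a"
proof -
  note simps = compatible_compose_iff[where q = 2] compatible_identity[where q = 2]
    identity_in_partitions compose_in_partitions a
  show "compose_partitions n a (identity_partition n) = a"
    by (rule partition_eqI[of _ n]) (simp_all add: simps cong: conj_cong bex_cong)
  show "compose_partitions n (identity_partition n) a = a"
    by (rule partition_eqI[of _ n]) (simp_all add: simps cong: conj_cong bex_cong)
qed

text \<open>With constant outer rows the identity forces the middle colouring to be the same
  constant, so the count is 1 and the exponent of 2 is 0.\<close>

lemma closed_parts_identity:
  assumes a: "a \<in> partitions n"
  shows "closed_parts n a (identity_partition n) = 0"
    and "closed_parts n (identity_partition n) a = 0"
proof -
  let ?i = "identity_partition n"
  let ?z = "restrict (\<lambda>_. 0) {1..n} :: nat \<Rightarrow> nat"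
  have z: "?z \<in> colourings 2 n" using const_in_colourings[of 2 n] by simp
  note zz = compatible_const[OF a, of 0]
  have "{g \<in> colourings 2 n. compatible a ?z g \<and> compatible ?i g ?z} = {?z}"
    "{g \<in> colourings 2 n. compatible ?i ?z g \<and> compatible a g ?z} = {?z}"
    using z zz by (auto simp only: compatible_identity cong: conj_cong)
  then have "2 ^ closed_parts n a ?i = (1::nat)" "2 ^ closed_parts n ?i a = (1::nat)"
    using card_compatible_const[OF a identity_in_partitions, of 2]
      card_compatible_const[OF identity_in_partitions a, of 2]
    by (simp_all add: compose_identity a)
  then show "closed_parts n a ?i = 0" "closed_parts n ?i a = 0" by simp_all
qed


section \<open>The ramified partition algebra is a ring\<close>

lemma ramified_partitions_iff:
  "a \<in> ramified_partitions d po n \<longleftrightarrow> a \<in> (\<Pi>\<^sub>E t\<in>{1..d}. partitions n) \<and>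
    (\<forall>t\<in>{1..d}. \<forall>t'\<in>{1..d}. (t, t') \<in> po \<longrightarrow> a t \<subseteq> a t')"
proof -
  have "refines (plain n \<union> primed n) (a t) (a t') \<longleftrightarrow> a t \<subseteq> a t'"
    if "a \<in> (\<Pi>\<^sub>E t\<in>{1..d}. partitions n)" "t \<in> {1..d}" "t' \<in> {1..d}" for t t'
    by (rule refines_iff_subset) (use PiE_mem[OF that(1)] that(2,3) in \<open>auto simp: partitions_def\<close>)
  then show ?thesis unfolding ramified_partitions_def by blast
qed

lemma ramified_partition_component:
  "a \<in> ramified_partitions d po n \<Longrightarrow> t \<in> {1..d} \<Longrightarrow> a t \<in> partitions n"
  by (auto simp: ramified_partitions_iff)

text \<open>Transitive closure, renaming and restriction all preserve inclusion; this is why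
  componentwise composition keeps tuples ramified.\<close>

lemma compose_partitions_mono:
  assumes "a \<subseteq> a'" "b \<subseteq> b'"
  shows "compose_partitions n a b \<subseteq> compose_partitions n a' b'"
proof -
  have "stack a b \<subseteq> stack a' b'"
    unfolding stack_def shift_def using assms by (intro trancl_mono_subset) blast
  then show ?thesis unfolding compose_partitions_def by blast
qed

lemma finite_partitions: "finite (partitions n)"
proof (rule finite_subset)
  show "partitions n \<subseteq> Pow ((plain n \<union> primed n) \<times> (plain n \<union> primed n))"
    by (auto simp: partitions_def equiv_def)
qed (simp add: plain_def primed_def)

lemma ramified_compose_closed:
  assumes a: "a \<in> ramified_partitions d po n" and b: "b \<in> ramified_partitions d po n"
  shows "ramified_compose d n a b \<in> ramified_partitions d po n"
proof -
  have "compose_partitions n (a t) (b t) \<subseteq> compose_partitions n (a t') (b t')"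
    if "t \<in> {1..d}" "t' \<in> {1..d}" "(t, t') \<in> po" for t t'
    by (rule compose_partitions_mono) (use assms that in \<open>simp_all add: ramified_partitions_iff\<close>)
  moreover have "compose_partitions n (a t) (b t) \<in> partitions n" if "t \<in> {1..d}" for t
    using that assms by (intro compose_in_partitions ramified_partition_component)
  ultimately show ?thesis
    by (simp add: ramified_partitions_iff ramified_compose_def)
qed

text \<open>The axioms hold one component at a time, the cocycle identity being the exponent
  identity \<open>closed_parts_cocycle\<close> for each \<open>t\<close>.\<close>

lemma twisted_monoid_ramified:
  fixes Q :: "nat \<Rightarrow> 'k::comm_ring_1"
  shows "twisted_monoid (ramified_partitions d po n) (ramified_compose d n) (ramified_identity d n)
    (\<lambda>a b. \<Prod>t\<in>{1..d}. Q t ^ closed_parts n (a t) (b t))"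
proof
  let ?P = "ramified_partitions d po n"
  note comp = ramified_partition_component[of _ d po n]
  have "finite (\<Pi>\<^sub>E t\<in>{1..d}. partitions n)" by (intro finite_PiE finite_partitions) simp
  then show "finite ?P" by (rule finite_subset[rotated]) (auto simp: ramified_partitions_def)
  show "ramified_identity d n \<in> ?P"
    by (auto simp: ramified_partitions_iff ramified_identity_def identity_in_partitions)
  fix a assume a: "a \<in> ?P"
  \<comment> \<open>Composition yields functions that are \<open>undefined\<close> outside
    \<open>{1..d}\<close>, so the unit laws use that \<open>a\<close> has this form too.\<close>
  have ext: "a = restrict a {1..d}"
    using a by (auto simp: ramified_partitions_iff PiE_def extensional_restrict)
  show "ramified_compose d n a (ramified_identity d n) = a"
    "ramified_compose d n (ramified_identity d n) a = a"
    by (subst (2) ext, auto simp: ramified_compose_def ramified_identity_def compose_identity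
      comp[OF a] intro!: restrict_ext)+
  show "(\<Prod>t\<in>{1..d}. Q t ^ closed_parts n (a t) (ramified_identity d n t)) = 1"
    "(\<Prod>t\<in>{1..d}. Q t ^ closed_parts n (ramified_identity d n t) (a t)) = 1"
    by (auto simp: ramified_identity_def closed_parts_identity comp[OF a] intro!: prod.neutral)
  fix b assume b: "b \<in> ?P"
  show "ramified_compose d n a b \<in> ?P" using ramified_compose_closed[OF a b] .
  fix c assume c: "c \<in> ?P"
  show "ramified_compose d n (ramified_compose d n a b) c =
      ramified_compose d n a (ramified_compose d n b c)"
    by (auto simp: ramified_compose_def compose_assoc comp[OF a] comp[OF b] comp[OF c]
      intro!: restrict_ext)
  show "(\<Prod>t\<in>{1..d}. Q t ^ closed_parts n (a t) (b t)) *
      (\<Prod>t\<in>{1..d}. Q t ^ closed_parts n (ramified_compose d n a b t) (c t)) =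
      (\<Prod>t\<in>{1..d}. Q t ^ closed_parts n (b t) (c t)) *
      (\<Prod>t\<in>{1..d}. Q t ^ closed_parts n (a t) (ramified_compose d n b c t))"
    unfolding prod.distrib[symmetric] power_add[symmetric]
    by (intro prod.cong refl) (simp add: ramified_compose_def closed_parts_cocycle
      comp[OF a] comp[OF b] comp[OF c])
qed


section \<open>A nonzero element \<open>x\<close> with \<open>x y x = 0\<close> for all \<open>y\<close>\<close>

definition edge_partition :: "nat \<Rightarrow> nat rel \<Rightarrow> point rel" where
  "edge_partition n E =
     {(Plain i, Plain j) |i j. i \<in> {1..n} \<and> j \<in> {1..n} \<and> (i, j) \<in> (E \<union> E\<inverse>)\<^sup>*} \<union>
     primed n \<times> primed n"

lemma edge_in_partitions: "edge_partition n E \<in> partitions n"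
proof -
  have "sym ((E \<union> E\<inverse>)\<^sup>*)" by (intro sym_rtrancl sym_Un_converse)
  then have sym: "(j, i) \<in> (E \<union> E\<inverse>)\<^sup>*" if "(i, j) \<in> (E \<union> E\<inverse>)\<^sup>*" for i j
    using that by (rule symD)
  have mem: "(x, y) \<in> edge_partition n E \<longleftrightarrow>
      (\<exists>i j. x = Plain i \<and> y = Plain j \<and> i \<in> {1..n} \<and> j \<in> {1..n} \<and> (i, j) \<in> (E \<union> E\<inverse>)\<^sup>*) \<or>
      x \<in> primed n \<and> y \<in> primed n" for x y
    by (auto simp: edge_partition_def)
  have disj: "Plain i \<notin> primed n" for i by (auto simp: primed_def)
  have "equiv (plain n \<union> primed n) (edge_partition n E)"
  proof (rule equivI)
    show "edge_partition n E \<subseteq> (plain n \<union> primed n) \<times> (plain n \<union> primed n)"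
      unfolding edge_partition_def plain_def by blast
    show "refl_on (plain n \<union> primed n) (edge_partition n E)"
      unfolding refl_on_def mem plain_def by blast
    show "sym (edge_partition n E)" unfolding sym_def mem using sym by blast
    show "trans (edge_partition n E)"
      unfolding trans_def mem using disj by (blast intro: rtrancl_trans)
  qed
  then show ?thesis by (simp add: partitions_def)
qed

lemma edge_partition_mono: "E \<subseteq> E' \<Longrightarrow> edge_partition n E \<subseteq> edge_partition n E'"
proof -
  assume "E \<subseteq> E'"
  then have "(E \<union> E\<inverse>)\<^sup>* \<subseteq> (E' \<union> E'\<inverse>)\<^sup>*" by (intro rtrancl_mono) auto
  then show ?thesis unfolding edge_partition_def by blast
qed

text \<open>No part meets both rows, so the condition splits into one on \<open>f\<close> and one on
  \<open>g\<close>: the matrix of \<open>edge_partition n E\<close> is a column vector times a row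
  vector, and the row vector is independent of \<open>E\<close>.\<close>

lemma compatible_edge:
  assumes "E \<subseteq> {1..n} \<times> {1..n}"
  shows "compatible (edge_partition n E) f g \<longleftrightarrow>
    (\<forall>(i, j)\<in>E. f i = f j) \<and> (\<forall>i\<in>{1..n}. \<forall>j\<in>{1..n}. g i = g j)"
proof
  assume c: "compatible (edge_partition n E) f g"
  have "f i = f j" if "(i, j) \<in> E" for i j
  proof -
    have "(Plain i, Plain j) \<in> edge_partition n E" using that assms by (auto simp: edge_partition_def)
    then show ?thesis using c by (auto simp: compatible_def)
  qed
  moreover have "g i = g j" if "i \<in> {1..n}" "j \<in> {1..n}" for i j
  proof -
    have "(Primed i, Primed j) \<in> edge_partition n E"
      using that by (auto simp: edge_partition_def primed_def)
    then show ?thesis using c by (auto simp: compatible_def)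
  qed
  ultimately show "(\<forall>(i, j)\<in>E. f i = f j) \<and> (\<forall>i\<in>{1..n}. \<forall>j\<in>{1..n}. g i = g j)" by blast
next
  assume *: "(\<forall>(i, j)\<in>E. f i = f j) \<and> (\<forall>i\<in>{1..n}. \<forall>j\<in>{1..n}. g i = g j)"
  have f: "f i = f j" if "(i, j) \<in> (E \<union> E\<inverse>)\<^sup>*" for i j
    using that by (induction rule: rtrancl_induct) (use conjunct1[OF *] in auto)
  have "colour f g g x = colour f g g y" if "(x, y) \<in> edge_partition n E" for x y
    using that unfolding edge_partition_def
  proof
    assume "(x, y) \<in> primed n \<times> primed n"
    then obtain i j where "x = Primed i" "y = Primed j" "i \<in> {1..n}" "j \<in> {1..n}"
      unfolding primed_def by blast
    then show ?thesis using bspec[OF bspec[OF conjunct2[OF *]], of i j] by simp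
  next
    assume "(x, y) \<in> {(Plain i, Plain j) |i j.
      i \<in> {1..n} \<and> j \<in> {1..n} \<and> (i, j) \<in> (E \<union> E\<inverse>)\<^sup>*}"
    then obtain i j where ij: "x = Plain i" "y = Plain j" "(i, j) \<in> (E \<union> E\<inverse>)\<^sup>*"
      by blast
    show ?thesis using f[OF ij(3)] ij(1,2) by simp
  qed
  then show "compatible (edge_partition n E) f g" by (auto simp: compatible_def)
qed

text \<open>Anything between two matrices of the form column times row contributes only a scalar,
  and the row vector is common to all edge sets. So \<open>E'\<close> leaves no trace in the
  composite.\<close>

lemma compose_edge_edge:
  assumes "E \<subseteq> {1..n} \<times> {1..n}" "E' \<subseteq> {1..n} \<times> {1..n}" and y: "y \<in> partitions n"
  shows "compose_partitions n (compose_partitions n (edge_partition n E) y) (edge_partition n E') =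
    edge_partition n E"
proof (rule partition_eqI[of _ n])
  let ?z = "restrict (\<lambda>_. 0) {1..n} :: nat \<Rightarrow> nat"
  fix f h assume "f \<in> colourings 2 n" "h \<in> colourings 2 n"
  then have "compatible (compose_partitions n (compose_partitions n (edge_partition n E) y)
      (edge_partition n E')) f h \<longleftrightarrow> (\<exists>g\<in>colourings 2 n. (\<exists>g'\<in>colourings 2 n.
        compatible (edge_partition n E) f g' \<and> compatible y g' g) \<and>
        compatible (edge_partition n E') g h)"
    using y by (simp add: compatible_compose_iff[where q = 2] edge_in_partitions
      compose_in_partitions)
  also have "\<dots> \<longleftrightarrow> compatible (edge_partition n E) f h"
  proof
    assume c: "compatible (edge_partition n E) f h"
    have "\<forall>(i, j)\<in>E'. ?z i = ?z j" "\<forall>i\<in>{1..n}. \<forall>j\<in>{1..n}. ?z i = ?z j"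
      using assms(2) by auto
    with c have "compatible (edge_partition n E) f ?z" "compatible (edge_partition n E') ?z h"
      unfolding compatible_edge[OF assms(1)] compatible_edge[OF assms(2)] by blast+
    \<comment> \<open>The zero colouring serves as both \<open>g\<close> and \<open>g'\<close>: it
      respects every partition, so the Boolean scalar is true.\<close>
    then show "\<exists>g\<in>colourings 2 n. (\<exists>g'\<in>colourings 2 n.
        compatible (edge_partition n E) f g' \<and> compatible y g' g) \<and>
        compatible (edge_partition n E') g h"
      using const_in_colourings[of 2 n] compatible_const[OF y, of 0]
      by (intro bexI[of _ ?z] conjI) simp_all
  next
    assume "\<exists>g\<in>colourings 2 n. (\<exists>g'\<in>colourings 2 n.
        compatible (edge_partition n E) f g' \<and> compatible y g' g) \<and>
        compatible (edge_partition n E') g h"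
    then show "compatible (edge_partition n E) f h"
      unfolding compatible_edge[OF assms(1)] compatible_edge[OF assms(2)] by blast
  qed
  finally show "compatible (compose_partitions n (compose_partitions n (edge_partition n E) y)
      (edge_partition n E')) f h \<longleftrightarrow> compatible (edge_partition n E) f h" .
qed (auto simp: edge_in_partitions compose_in_partitions y)

section \<open>Cancellation in alternating sums over edge sets\<close>

text \<open>Among \<open>q + 1\<close> points, every \<open>q\<close>-colouring \<open>g\<close> has an edge with both ends of the same colour;
  adding or removing that edge pairs off the terms that survive for \<open>g\<close>.\<close>

lemma alternating_sum_constant_on_edges:
  fixes q :: nat
  assumes g: "g \<in> colourings q n" and "q < n"
  defines "K \<equiv> {(i, j). 1 \<le> i \<and> i < j \<and> j \<le> q + 1}"
  shows "(\<Sum>E\<in>Pow K. (- 1) ^ card E * of_bool (\<forall>(i, j)\<in>E. g i = g j)) = (0 :: 'k::comm_ring_1)"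
proof -
  have "finite K" by (rule finite_subset[of _ "{..q + 1} \<times> {..q + 1}"]) (auto simp: K_def)
  have "\<not> inj_on g {1..q + 1}"
  proof
    assume "inj_on g {1..q + 1}"
    moreover have "g ` {1..q + 1} \<subseteq> {..<q}" using g \<open>q < n\<close> by (auto simp: colourings_def)
    ultimately have "card {1..q + 1} \<le> card {..<q}" by (intro card_inj_on_le[of g]) auto
    then show False by simp
  qed
  then obtain i j where ij: "i \<in> {1..q + 1}" "j \<in> {1..q + 1}" "i < j" "g i = g j"
    unfolding inj_on_def by (metis linorder_neqE_nat)
  define L where "L = K - {(i, j)}"
  let ?w = "\<lambda>E. (- 1) ^ card E * of_bool (\<forall>(i, j)\<in>E. g i = g j) :: 'k"
  have K: "K = insert (i, j) L" "(i, j) \<notin> L" "finite L"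
    using ij \<open>finite K\<close> by (auto simp: K_def L_def)
  have "sum ?w (Pow K) = sum ?w (Pow L) + sum ?w (insert (i, j) ` Pow L)"
    unfolding K(1) Pow_insert using K(2,3) by (intro sum.union_disjoint) auto
  also have "sum ?w (insert (i, j) ` Pow L) = (\<Sum>E\<in>Pow L. ?w (insert (i, j) E))"
  proof (subst sum.reindex)
    show "inj_on (insert (i, j)) (Pow L)"
      using K(2) by (intro inj_onI) (metis PowD insert_ident subsetD)
  qed simp
  also have "\<dots> = (\<Sum>E\<in>Pow L. - ?w E)"
  proof (intro sum.cong refl)
    fix E assume "E \<in> Pow L"
    then have "finite E" "(i, j) \<notin> E" using K(2,3) finite_subset by auto
    then show "?w (insert (i, j) E) = - ?w E" using ij(4) by simp
  qed
  finally show ?thesis by (simp add: sum_negf)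
qed

text \<open>\<open>card_compatible_const\<close> turns each power of \<open>q\<close> into a sum
  over colourings \<open>g\<close>, the weight from \<open>a\<close> being independent of
  \<open>E\<close>. After interchanging the sums, the alternating sum over \<open>E\<close> vanishes
  for each \<open>g\<close>.\<close>

lemma alternating_sum_closed_parts:
  fixes q :: nat
  assumes a: "a \<in> partitions n" and "0 < q" "q < n"
  defines "K \<equiv> {(i, j). 1 \<le> i \<and> i < j \<and> j \<le> q + 1}"
  shows "(\<Sum>E\<in>Pow K. (- 1) ^ card E * of_nat q ^ closed_parts n a (edge_partition n E)) =
    (0 :: 'k::comm_ring_1)"
proof -
  let ?C = "colourings q n"
  define z :: "nat \<Rightarrow> nat" where "z = restrict (\<lambda>_. 0) {1..n}"
  have "of_nat q ^ closed_parts n a (edge_partition n E) =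
      (\<Sum>g\<in>?C. of_bool (compatible a z g) * of_bool (\<forall>(i, j)\<in>E. g i = g j) :: 'k)"
    if "E \<in> Pow K" for E
  proof -
    have E: "E \<subseteq> {1..n} \<times> {1..n}" using that \<open>q < n\<close> by (auto simp: K_def)
    have "of_nat q ^ closed_parts n a (edge_partition n E) =
        (of_nat (card {g \<in> ?C. compatible a z g \<and> compatible (edge_partition n E) g z}) :: 'k)"
      unfolding z_def using a \<open>0 < q\<close>
      by (subst card_compatible_const) (auto simp: edge_in_partitions compose_in_partitions)
    also have "\<dots> = (\<Sum>g\<in>?C. of_bool (compatible a z g \<and> compatible (edge_partition n E) g z))"
      by (simp add: sum_of_bool_eq Int_def)
    also have "\<dots> = (\<Sum>g\<in>?C. of_bool (compatible a z g) * of_bool (\<forall>(i, j)\<in>E. g i = g j))"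
      \<comment> \<open>The constant \<open>z\<close> meets the condition on the primed row
        automatically, leaving only the condition on the edges.\<close>
      by (intro sum.cong refl) (auto simp: compatible_edge[OF E] z_def)
    finally show ?thesis .
  qed
  then have "(\<Sum>E\<in>Pow K. (- 1) ^ card E * of_nat q ^ closed_parts n a (edge_partition n E)) =
      (\<Sum>E\<in>Pow K. \<Sum>g\<in>?C. of_bool (compatible a z g) *
        ((- 1) ^ card E * of_bool (\<forall>(i, j)\<in>E. g i = g j)) :: 'k)"
    by (intro sum.cong refl)
      (simp add: sum_distrib_left mult_ac del: sum_mult_of_bool_eq sum_of_bool_mult_eq of_bool_conj)
  also have "\<dots> = (\<Sum>g\<in>?C. of_bool (compatible a z g) *
      (\<Sum>E\<in>Pow K. (- 1) ^ card E * of_bool (\<forall>(i, j)\<in>E. g i = g j)))"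
    by (subst sum.swap) (simp add: sum_distrib_left)
  also have "\<dots> = 0"
    using alternating_sum_constant_on_edges[OF _ \<open>q < n\<close>, where ?'k = 'k]
    by (intro sum.neutral) (simp add: K_def)
  finally show ?thesis .
qed

section \<open>Lifting edge partitions to ramified tuples\<close>

lemma partial_order_on_minimal:
  assumes po: "partial_order_on A po" and "finite A" "A \<noteq> {}"
  obtains m where "m \<in> A" "\<And>t. t \<in> A \<Longrightarrow> (t, m) \<in> po \<Longrightarrow> t = m"
proof -
  have "antisym po" "trans po" using po by (auto simp: partial_order_on_def preorder_on_def)
  then have "asymp_on A (\<lambda>x y. (x, y) \<in> po \<and> x \<noteq> y)" "transp_on A (\<lambda>x y. (x, y) \<in> po \<and> x \<noteq> y)"
    by (auto intro!: asymp_onI transp_onI dest: antisymD transD)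
  from Finite_Set.bex_min_element[OF \<open>finite A\<close> this \<open>A \<noteq> {}\<close>] show ?thesis
    using that by blast
qed

text \<open>The complete relation \<open>{1..n} \<times> {1..n}\<close> is connected, so every entry
  other than the one at \<open>m\<close> has just the two rows as parts.\<close>

definition ramified_edge_partition :: "nat \<Rightarrow> nat \<Rightarrow> nat \<Rightarrow> nat rel \<Rightarrow> nat \<Rightarrow> point rel" where
  "ramified_edge_partition d n m E =
     (\<lambda>t\<in>{1..d}. edge_partition n (if t = m then E else {1..n} \<times> {1..n}))"

text \<open>Below \<open>m\<close> there is only \<open>m\<close> itself, and the entry at any other
  index comes from the complete relation, which contains \<open>E\<close>. Hence \<open>E\<close>
  can vary freely at \<open>m\<close>.\<close>

lemma ramified_edge_in_ramified_partitions:
  assumes "E \<subseteq> {1..n} \<times> {1..n}" and "\<And>t. t \<in> {1..d} \<Longrightarrow> (t, m) \<in> po \<Longrightarrow> t = m"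
  shows "ramified_edge_partition d n m E \<in> ramified_partitions d po n"
proof -
  have "edge_partition n (if t = m then E else {1..n} \<times> {1..n}) \<subseteq>
      edge_partition n (if t' = m then E else {1..n} \<times> {1..n})"
    if "t \<in> {1..d}" "(t, t') \<in> po" for t t'
    using assms that by (intro edge_partition_mono) auto
  then show ?thesis
    unfolding ramified_partitions_iff
    by (auto simp: ramified_edge_partition_def edge_in_partitions simp del: subset_iff)
qed

text \<open>The result does not involve \<open>E'\<close>: as the right-hand factor varies over edge
  sets only the scalar changes, so a signed sum can cancel within a single coefficient.\<close>

lemma ramified_edge_sandwich:
  assumes E: "E \<subseteq> {1..n} \<times> {1..n}" "E' \<subseteq> {1..n} \<times> {1..n}"
    and y: "y \<in> ramified_partitions d po n"
  shows "ramified_compose d n (ramified_compose d n (ramified_edge_partition d n m E) y)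
    (ramified_edge_partition d n m E') = ramified_edge_partition d n m E"
  unfolding ramified_compose_def ramified_edge_partition_def
proof (rule restrict_ext, goal_cases)
  case (1 t)
  let ?F = "\<lambda>E. if t = m then E else {1..n} \<times> {1..n}"
  have "compose_partitions n (compose_partitions n (edge_partition n (?F E)) (y t))
      (edge_partition n (?F E')) = edge_partition n (?F E)"
    by (rule compose_edge_edge[OF _ _ ramified_partition_component[OF y 1]]) (use E in auto)
  then show ?case using 1 by (simp only: restrict_apply if_True)
qed

text \<open>An edge with \<open>i < j\<close> joins two distinct points that the empty graph
  separates. This keeps the term of the empty edge set in \<open>x\<close> from cancelling.\<close>

lemma edge_partition_eq_empty:
  assumes "edge_partition n E = edge_partition n {}" and "E \<subseteq> {(i, j). 1 \<le> i \<and> i < j \<and> j \<le> n}"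
  shows "E = {}"
proof (rule ccontr)
  assume "E \<noteq> {}"
  then obtain i j where "(i, j) \<in> E" by auto
  moreover from this have "1 \<le> i" "i < j" "j \<le> n" using assms(2) by auto
  ultimately have "(Plain i, Plain j) \<in> edge_partition n E" "(Plain i, Plain j) \<notin> edge_partition n {}"
    by (auto simp: edge_partition_def primed_def)
  then show False using assms(1) by simp
qed

theorem theorem2:
  fixes d :: nat and po :: "nat rel" and Q :: "nat \<Rightarrow> nat"
  assumes "d \<ge> 1"
    and "partial_order_on {1..d} po"
    and "\<forall>t\<in>{1..d}. Q t > 0"
  shows "\<exists>m. \<forall>n>m. \<not> semisimple_ring
           (ramified_partition_algebra d po n (\<lambda>t. of_nat (Q t) :: 'k::field))"
proof -
  obtain m where m: "m \<in> {1..d}" "\<And>t. t \<in> {1..d} \<Longrightarrow> (t, m) \<in> po \<Longrightarrow> t = m"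
    using partial_order_on_minimal[OF assms(2)] \<open>d \<ge> 1\<close> by auto
  \<comment> \<open>The bound is \<open>Q m\<close> at the minimal index \<open>m\<close>: then
    there is room for \<open>Q m + 1\<close> points, to be coloured with \<open>Q m\<close>
    colours.\<close>
  have "\<not> semisimple_ring (ramified_partition_algebra d po n (\<lambda>t. of_nat (Q t) :: 'k))"
    if n: "n > Q m" for n
  proof
    let ?A = "ramified_partition_algebra d po n (\<lambda>t. of_nat (Q t) :: 'k)"
    let ?P = "ramified_partitions d po n"
    let ?c = "ramified_compose d n"
    define s where "s a b = (\<Prod>t\<in>{1..d}. of_nat (Q t) ^ closed_parts n (a t) (b t) :: 'k)" for a b
    interpret twisted_monoid ?P ?c "ramified_identity d n" s
      unfolding s_def by (rule twisted_monoid_ramified)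
    have mult_A: "mult ?A = product"
      by (intro ext) (simp add: ramified_partition_algebra_def product_def s_def cong: if_cong)
    interpret A: ring ?A
      by (rule ring_twisted_algebra[OF _ mult_A]) (simp_all add: ramified_partition_algebra_def)
    \<comment> \<open>Each edge occurs once, with \<open>i < j\<close>, so that
      \<open>card E\<close> is the number of edges.\<close>
    define K where "K = {(i, j). 1 \<le> i \<and> i < j \<and> j \<le> Q m + 1}"
    let ?e = "ramified_edge_partition d n m"
    \<comment> \<open>Edge sets with the same components give the same tuple and their signs add up,
      hence a sum over \<open>E\<close> in each coefficient.\<close>
    define x where "x a = (\<Sum>E\<in>Pow K. if a = ?e E then (- 1) ^ card E else 0 :: 'k)" for a
    have finK: "finite K" by (rule finite_subset[of _ "{..Q m + 1} \<times> {..Q m + 1}"]) (auto simp: K_def)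
    have K: "E \<subseteq> {1..n} \<times> {1..n}" if "E \<in> Pow K" for E
      using that n by (auto simp: K_def)
    have eP: "?e E \<in> ?P" if "E \<in> Pow K" for E
      using ramified_edge_in_ramified_partitions[OF K[OF that] m(2)] .
    have x0: "\<exists>E\<in>Pow K. a = ?e E" if "x a \<noteq> 0" for a
      using that unfolding x_def by (rule contrapos_np) (auto intro!: sum.neutral)
    have xA: "x \<in> carrier ?A"
      using x0 eP by (fastforce simp: ramified_partition_algebra_def)
    assume "semisimple_ring ?A"
    moreover note xA
    moreover have "x \<otimes>\<^bsub>?A\<^esub> y \<otimes>\<^bsub>?A\<^esub> x = \<zero>\<^bsub>?A\<^esub>" for y
    proof
      fix c
      \<comment> \<open>This is the inner sum of \<open>product_product_left\<close>. It suffices to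
        treat \<open>a\<close> in the support of \<open>x\<close>, as all other terms carry the
        factor \<open>x a = 0\<close>.\<close>
      have "(\<Sum>r\<in>?P. if ?c (?c a b) r = c then x r * s (?c a b) r else 0) = 0"
        if a: "x a \<noteq> 0" and b: "b \<in> ?P" for a b
      proof -
        obtain E where E: "E \<in> Pow K" "a = ?e E" using x0[OF a] by blast
        define u where "u = ?c a b"
        have uP: "u \<in> ?P" unfolding u_def using eP E b comp_closed by blast
        have cu: "?c u (?e E') = a" if "E' \<in> Pow K" for E'
          unfolding u_def E(2) by (rule ramified_edge_sandwich[OF K[OF E(1)] K[OF that] b])
        \<comment> \<open>Only the factor at \<open>m\<close> depends on \<open>E'\<close>; the
          others come out of the alternating sum.\<close>
        have su: "s u (?e E') = (\<Prod>t\<in>{1..d} - {m}. of_nat (Q t) ^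
            closed_parts n (u t) (edge_partition n ({1..n} \<times> {1..n}))) *
            of_nat (Q m) ^ closed_parts n (u m) (edge_partition n E')" for E'
          unfolding s_def using m(1)
          by (subst prod.remove[of _ m]) (auto simp: ramified_edge_partition_def intro!: prod.cong)
        have "(\<Sum>r\<in>?P. if ?c u r = c then x r * s u r else 0) =
            (\<Sum>r\<in>?P. \<Sum>E'\<in>Pow K. if r = ?e E' then
              (if ?c u r = c then (- 1) ^ card E' * s u r else 0) else 0)"
          by (intro sum.cong refl) (auto simp: x_def sum_distrib_right intro!: sum.cong sum.neutral)
        also have "\<dots> = (\<Sum>E'\<in>Pow K. if a = c then (- 1) ^ card E' * s u (?e E') else 0)"
          by (subst sum.swap) (use eP cu finite_P in \<open>auto intro!: sum.cong\<close>)
        also have "\<dots> = of_bool (a = c) * (\<Prod>t\<in>{1..d} - {m}. of_nat (Q t) ^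
            closed_parts n (u t) (edge_partition n ({1..n} \<times> {1..n}))) *
            (\<Sum>E'\<in>Pow K. (- 1) ^ card E' *
              of_nat (Q m) ^ closed_parts n (u m) (edge_partition n E'))"
          unfolding sum_distrib_left by (intro sum.cong refl) (simp add: su mult_ac)
        also have "\<dots> = 0"
          using alternating_sum_closed_parts[OF ramified_partition_component[OF uP m(1)] _ n,
            where ?'k = 'k] assms(3) m(1)
          by (simp add: K_def)
        finally show ?thesis unfolding u_def .
      qed
      then have "x a * y b * s a b * (\<Sum>r\<in>?P. if ?c (?c a b) r = c then x r * s (?c a b) r else 0) = 0"
        if "b \<in> ?P" for a b
        using that by (metis (no_types, lifting) mult_zero_left mult_zero_right)
      then have "product (product x y) x c = 0"
        unfolding product_product_left by (intro sum.neutral ballI)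
      then show "(x \<otimes>\<^bsub>?A\<^esub> y \<otimes>\<^bsub>?A\<^esub> x) c = \<zero>\<^bsub>?A\<^esub> c"
        by (simp add: mult_A) (simp add: ramified_partition_algebra_def)
    qed
    ultimately have "x = \<zero>\<^bsub>?A\<^esub>" by (rule A.semisimple_ring_semiprime)
    then have "x (?e {}) = 0" by (simp add: ramified_partition_algebra_def)
    \<comment> \<open>Only the empty edge set yields the tuple \<open>?e {}\<close>, so its
      coefficient is 1 and \<open>x\<close> is nonzero.\<close>
    moreover have "x (?e {}) = (\<Sum>E\<in>Pow K. if E = {} then 1 else 0)"
      unfolding x_def
    proof (intro sum.cong refl)
      fix E assume E: "E \<in> Pow K"
      have "E = {}" if "?e {} = ?e E"
        using edge_partition_eq_empty[of n E] fun_cong[OF that, of m] m(1) E n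
        by (fastforce simp: ramified_edge_partition_def K_def)
      then show "(if ?e {} = ?e E then (- 1) ^ card E else 0) = (if E = {} then 1 else 0 :: 'k)"
        by auto
    qed
    ultimately show False using finK by simp
  qed
  then show ?thesis by blast
qed

end
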